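(* Let $A\subset\mathbb{Z}^d$ be finite with $\mathbb{Z}$-linear span $\mathbb{Z}^d$ and $f=\bigoplus_{i\in A}p_i\odot w^i$ a tropical polynomial with support $A$. The weight classes of $f$ are finitely many relatively open polyhedral cells, and they refine the polyhedral structure of $\mathcal{T}(f)$ given by the relative interiors of the dual cells $\sigma^*$ of the marked subdivision $\Pi_p$ (each weight class is contained in the relative interior of a single $\sigma^*$). If $C$ is one of these weight classes, then either all points of $C$ are singular points of $\mathcal{T}(f)$ or none of them is.
   Context: $\mathbb{K}$ is an algebraically closed field of characteristic $0$ with a rank-one non-archimedean valuation $val$ whose residue field has characteristic $0$. Tropical operations $\oplus=\min$, $\odot=+$; $f(w)=\min_{i\in A}(p_i+\langle i,w\rangle)$, all $p_i\in\mathbb{R}$; $\mathcal{T}(f)$ is where this minimum is attained at least twice. A point $q\in\mathcal{T}(f)$ is singular if there exist $F=\sum_{i\in A}a_ix^i$ over $\mathbb{K}$ with $val(a_i)=p_i$ and $b\in(\mathbb{K}^* )^d$ with $val(b)=q$, $F(b)=0$ and all $\partial F/\partial x_j(b)=0$. For $q\in\mathbb{R}^d$, $\sigma_q=\{i\in A:p_i+\langle i,q\rangle=f(q)\}$; the marked cells of $\Pi_p$ are the sets $\sigma_q$, and the dual cell $\sigma^*$ is the closure of $\{q:\sigma_q=\sigma\}$ (with relative interior $\{q:\sigma_q=\sigma\}$). $\langle S\rangle$ denotes the affine span. Flag of $f$ at $q\in\mathcal{T}(f)$: $F_0(q)=\sigma_q$, and inductively, while $\dim\langle F_\ell(q)\rangle<d$,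 $F_{\ell+1}(q)=F_\ell(q)\cup M_\ell$ where $M_\ell$ is the set of $i\in A\setminus\langle F_\ell(q)\rangle$ at which $\min_{i\in A\setminus\langle F_\ell(q)\rangle}(p_i+\langle i,q\rangle)$ is attained; the flag $\mathcal{F}(q)=(F_0(q)\subsetneq F_1(q)\subsetneq\dots\subsetneq F_r(q))$ stops when $\dim\langle F_r(q)\rangle=d$. The weight class of $q$ is $\{q'\in\mathcal{T}(f):\mathcal{F}(q')=\mathcal{F}(q)\}$. *)

theory Defs
  imports "HOL-Analysis.Analysis" "HOL-Computational_Algebra.Polynomial"
begin

text \<open>Exponent vectors live in int^'n (d = CARD('n)); points of R^d in real^'n.\<close>

definition rv :: "int^'n \<Rightarrow> real^'n" where
  "rv i = (\<chi> j. real_of_int (i $ j))"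

definition Z_span :: "(int^'n) set \<Rightarrow> (int^'n) set" where
  "Z_span A = {z. \<exists>c :: int^'n \<Rightarrow> int. z = (\<Sum>i\<in>A. c i *s i)}"

definition trop_val :: "(int^'n) set \<Rightarrow> (int^'n \<Rightarrow> real) \<Rightarrow> real^'n \<Rightarrow> real" where
  "trop_val A p w = Min ((\<lambda>i. p i + rv i \<bullet> w) ` A)"

definition sigma :: "(int^'n) set \<Rightarrow> (int^'n \<Rightarrow> real) \<Rightarrow> real^'n \<Rightarrow> (int^'n) set" where
  "sigma A p q = {i \<in> A. p i + rv i \<bullet> q = trop_val A p q}"

definition trop_hypersurface :: "(int^'n) set \<Rightarrow> (int^'n \<Rightarrow> real) \<Rightarrow> (real^'n) set" where
  "trop_hypersurface A p = {q. card (sigma A p q) \<ge> 2}"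

definition dual_cell :: "(int^'n) set \<Rightarrow> (int^'n \<Rightarrow> real) \<Rightarrow> (int^'n) set \<Rightarrow> (real^'n) set" where
  "dual_cell A p \<sigma> = closure {q. sigma A p q = \<sigma>}"

definition argmin_set :: "(int^'n \<Rightarrow> real) \<Rightarrow> real^'n \<Rightarrow> (int^'n) set \<Rightarrow> (int^'n) set" where
  "argmin_set p q S = {i \<in> S. \<forall>k\<in>S. p i + rv i \<bullet> q \<le> p k + rv k \<bullet> q}"

text \<open>The flag as a sequence F_0, F_1, ...; once dim <F_l> = d it stays constant.\<close>
primrec flag_seq :: "(int^'n) set \<Rightarrow> (int^'n \<Rightarrow> real) \<Rightarrow> real^'n \<Rightarrow> nat \<Rightarrow> (int^'n) set" where
  "flag_seq A p q 0 = sigma A p q"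
| "flag_seq A p q (Suc l) =
     (if aff_dim (rv ` flag_seq A p q l) < int CARD('n)
      then flag_seq A p q l \<union>
           argmin_set p q (A - {i. rv i \<in> affine hull (rv ` flag_seq A p q l)})
      else flag_seq A p q l)"

definition weight_class :: "(int^'n) set \<Rightarrow> (int^'n \<Rightarrow> real) \<Rightarrow> real^'n \<Rightarrow> (real^'n) set" where
  "weight_class A p q = {q' \<in> trop_hypersurface A p. flag_seq A p q' = flag_seq A p q}"

definition weight_classes :: "(int^'n) set \<Rightarrow> (int^'n \<Rightarrow> real) \<Rightarrow> (real^'n) set set" where
  "weight_classes A p = weight_class A p ` trop_hypersurface A p"

text \<open>Valued field: val defined on nonzero elements, rank one (real values),
  non-archimedean, value group all of R, residue field of characteristic 0.\<close>
definition nonarch_valuation :: "('k::field_char_0 \<Rightarrow> real) \<Rightarrow> bool" where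
  "nonarch_valuation val \<longleftrightarrow>
     (\<forall>x y. x \<noteq> 0 \<and> y \<noteq> 0 \<longrightarrow> val (x * y) = val x + val y) \<and>
     (\<forall>x y. x \<noteq> 0 \<and> y \<noteq> 0 \<and> x + y \<noteq> 0 \<longrightarrow> val (x + y) \<ge> min (val x) (val y)) \<and>
     (\<forall>r. \<exists>x. x \<noteq> 0 \<and> val x = r) \<and>
     (\<forall>n::nat. n > 0 \<longrightarrow> val (of_nat n) = 0)"

definition alg_closed :: "'k::field itself \<Rightarrow> bool" where
  "alg_closed _ \<longleftrightarrow> (\<forall>P :: 'k poly. degree P \<ge> 1 \<longrightarrow> (\<exists>x. poly P x = 0))"

definition mono_eval :: "'k::field ^'n \<Rightarrow> int^'n \<Rightarrow> 'k" where
  "mono_eval b i = (\<Prod>j\<in>UNIV. (b $ j) powi (i $ j))"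

definition singular_point ::
  "('k::field_char_0 \<Rightarrow> real) \<Rightarrow> (int^'n) set \<Rightarrow> (int^'n \<Rightarrow> real) \<Rightarrow> real^'n \<Rightarrow> bool" where
  "singular_point val A p q \<longleftrightarrow> q \<in> trop_hypersurface A p \<and>
     (\<exists>(a :: int^'n \<Rightarrow> 'k) (b :: 'k^'n).
        (\<forall>i\<in>A. a i \<noteq> 0 \<and> val (a i) = p i) \<and>
        (\<forall>j. b $ j \<noteq> 0 \<and> val (b $ j) = q $ j) \<and>
        (\<Sum>i\<in>A. a i * mono_eval b i) = 0 \<and>
        (\<forall>j. (\<Sum>i\<in>A. a i * of_int (i $ j) * mono_eval b (i - axis j 1)) = 0))"

end

theory Submission
  imports Defs
begin

(* A point q of T(f) is singular iff there are nonzero c_k in K with val c_k = p_k + <k,q> and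
   sum_k c_k = 0, sum_k c_k k = 0 (put c_k = a_k b^k).  Ultrametric cancellation shows that such c
   exist iff no point entering the flag at some step is a coloop of that stage, i.e. each lies in
   the affine span of the other points of its stage.  A coloop is separated from the rest of its
   stage by a rational affine form phi, and then sum_k c_k phi(k) has a unique term of least
   valuation.  Conversely, every point then has a rational affine relation with points of no larger
   weight, and a generic combination of these relations, scaled by elements of the right
   valuations, gives c.  The criterion depends only on the flag, hence is constant on weight
   classes.  The weight class of q0 is cut out by asking that the minimizers of p_i + <i,q> over the
   sets A - <F_l(q0)> do not change, i.e. by finitely many linear equations and strict
   inequalities, so it is the relative interior of a polyhedron; as F_0(q) = sigma_q, it lies in
   the relative interior of a single dual cell. *)

section \<open>Ultrametric valuations\<close>

locale ultrametric_valuation =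
  fixes val :: "'k::field_char_0 \<Rightarrow> real"
  assumes nonarch_valuation: "nonarch_valuation val"
begin

lemma val_mult: "x \<noteq> 0 \<Longrightarrow> y \<noteq> 0 \<Longrightarrow> val (x * y) = val x + val y"
  using nonarch_valuation unfolding nonarch_valuation_def by blast

lemma val_add: "x \<noteq> 0 \<Longrightarrow> y \<noteq> 0 \<Longrightarrow> x + y \<noteq> 0 \<Longrightarrow> min (val x) (val y) \<le> val (x + y)"
  using nonarch_valuation unfolding nonarch_valuation_def by blast

lemma val_surj: "\<exists>x. x \<noteq> 0 \<and> val x = r"
  using nonarch_valuation unfolding nonarch_valuation_def by blast

lemma val_of_nat: "n > 0 \<Longrightarrow> val (of_nat n) = 0"
  using nonarch_valuation unfolding nonarch_valuation_def by blast

lemma val_one: "val 1 = 0"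
  using val_of_nat[of 1] by simp

lemma val_inverse: "x \<noteq> 0 \<Longrightarrow> val (inverse x) = - val x"
  using val_mult[of x "inverse x"] val_one by simp

lemma val_divide: "x \<noteq> 0 \<Longrightarrow> y \<noteq> 0 \<Longrightarrow> val (x / y) = val x - val y"
  by (simp add: divide_inverse val_mult val_inverse)

lemma val_minus: "x \<noteq> 0 \<Longrightarrow> val (- x) = val x"
  using val_mult[of "-1" "-1"] val_mult[of "-1" x] val_one by simp

lemma val_of_int: "z \<noteq> 0 \<Longrightarrow> val (of_int z) = 0"
proof -
  assume "z \<noteq> 0"
  then have n: "val (of_int \<bar>z\<bar>) = 0"
    using val_of_nat[of "nat \<bar>z\<bar>"] by simp
  show ?thesis
  proof (cases "z > 0")
    case False
    then have "(of_int z :: 'k) = - of_int \<bar>z\<bar>" by simp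
    then show ?thesis using n val_minus[of "of_int \<bar>z\<bar>"] \<open>z \<noteq> 0\<close> by simp
  qed (use n in simp)
qed

lemma val_of_rat: "r \<noteq> 0 \<Longrightarrow> val (of_rat r) = 0"
proof -
  assume r: "r \<noteq> 0"
  obtain a b where ab: "quotient_of r = (a, b)" by fastforce
  then have "r = of_int a / of_int b" "b > 0" by (simp_all add: quotient_of_div quotient_of_denom_pos)
  moreover from this r have "a \<noteq> 0" by auto
  ultimately show ?thesis by (simp add: of_rat_divide val_divide val_of_int)
qed

lemma val_mult_of_rat: "x \<noteq> 0 \<Longrightarrow> r \<noteq> 0 \<Longrightarrow> val (x * of_rat r) = val x"
  by (simp add: val_mult val_of_rat)

lemma val_power_int: "x \<noteq> 0 \<Longrightarrow> val (x powi z) = of_int z * val x"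
proof -
  assume x: "x \<noteq> 0"
  have "val (y ^ n) = real n * val y" if "y \<noteq> 0" for y :: 'k and n
    using that by (induction n) (auto simp: val_one val_mult algebra_simps)
  then show ?thesis using x by (auto simp: power_int_def val_inverse)
qed

lemma val_prod: "finite I \<Longrightarrow> (\<forall>i\<in>I. f i \<noteq> 0) \<Longrightarrow> val (prod f I) = (\<Sum>i\<in>I. val (f i))"
  by (induction I rule: finite_induct) (auto simp: val_one val_mult)

text \<open>\<open>val_gt a x\<close> says \<open>val x > a\<close> under the convention \<open>val 0 = \<infinity>\<close>.\<close>
definition val_gt :: "real \<Rightarrow> 'k \<Rightarrow> bool" where
  "val_gt a x \<longleftrightarrow> x = 0 \<or> a < val x"

lemma val_gt_add: "val_gt a x \<Longrightarrow> val_gt a y \<Longrightarrow> val_gt a (x + y)"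
proof -
  assume x: "val_gt a x" and y: "val_gt a y"
  show ?thesis
  proof (cases "x = 0 \<or> y = 0 \<or> x + y = 0")
    case False
    then show ?thesis using x y val_add[of x y] by (auto simp: val_gt_def)
  qed (use x y in \<open>auto simp: val_gt_def\<close>)
qed

lemma val_gt_sum: "(\<And>i. i \<in> I \<Longrightarrow> val_gt a (f i)) \<Longrightarrow> val_gt a (sum f I)"
  by (induction I rule: infinite_finite_induct) (auto simp: val_gt_def[of a 0] intro: val_gt_add)

lemma val_gt_mult_of_rat: "x \<noteq> 0 \<Longrightarrow> a < val x \<Longrightarrow> val_gt a (x * of_rat r)"
  by (cases "r = 0") (simp_all add: val_gt_def val_mult_of_rat)

lemma val_add_dominant:
  assumes "x \<noteq> 0" "val_gt (val x) y"
  shows "x + y \<noteq> 0 \<and> val (x + y) = val x"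
proof (cases "y = 0")
  case False
  then have vy: "val x < val y" using assms(2) by (simp add: val_gt_def)
  have ne: "x + y \<noteq> 0"
  proof
    assume "x + y = 0"
    then have "x = - y" by (simp add: eq_neg_iff_add_eq_0)
    then show False using vy val_minus[OF False] by simp
  qed
  have "min (val (x + y)) (val (- y)) \<le> val x"
    using val_add[of "x + y" "- y"] ne False assms(1) by simp
  then show ?thesis using val_add[OF assms(1) False ne] vy ne val_minus[OF False] by linarith
qed (use assms in simp)

lemma sum_nonzero_if_dominant:
  assumes "finite A" "i \<in> A" "f i \<noteq> 0" "\<forall>k\<in>A - {i}. val_gt (val (f i)) (f k)"
  shows "sum f A \<noteq> 0"
  using val_add_dominant[OF assms(3) val_gt_sum[of "A - {i}"]] assms by (simp add: sum.remove)

text \<open>\<open>e\<close> picks an element of each valuation; the terms of least weight \<open>a\<close> share the factor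
  \<open>e a\<close>, so they cannot cancel unless their rational coefficients do.\<close>
lemma val_sum_leading:
  fixes r :: "'i \<Rightarrow> rat"
  assumes "finite I" "\<forall>i\<in>I. r i \<noteq> 0 \<longrightarrow> a \<le> w i" "(\<Sum>i\<in>I \<inter> {i. w i = a}. r i) \<noteq> 0"
    and "\<forall>x. e x \<noteq> 0 \<and> val (e x) = x"
  shows "(\<Sum>i\<in>I. e (w i) * of_rat (r i)) \<noteq> 0 \<and> val (\<Sum>i\<in>I. e (w i) * of_rat (r i)) = a"
proof -
  let ?lead = "e a * of_rat (\<Sum>i\<in>I \<inter> {i. w i = a}. r i)"
  let ?rest = "\<Sum>i\<in>I - {i. w i = a}. e (w i) * of_rat (r i)"
  have "(\<Sum>i\<in>I. e (w i) * of_rat (r i)) = (\<Sum>i\<in>I \<inter> {i. w i = a}. e (w i) * of_rat (r i)) + ?rest"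
    by (rule sum.Int_Diff[OF assms(1)])
  also have "(\<Sum>i\<in>I \<inter> {i. w i = a}. e (w i) * of_rat (r i)) = ?lead"
    by (simp add: sum_distrib_left of_rat_sum)
  finally have sum: "(\<Sum>i\<in>I. e (w i) * of_rat (r i)) = ?lead + ?rest" .
  have lead: "?lead \<noteq> 0" "val ?lead = a"
    using assms(3,4) by (simp_all add: val_mult_of_rat)
  have "val_gt a ?rest"
  proof (rule val_gt_sum)
    fix i assume i: "i \<in> I - {i. w i = a}"
    show "val_gt a (e (w i) * of_rat (r i))"
    proof (cases "r i = 0")
      case False
      then have "a < w i" using assms(2) i by force
      then show ?thesis using assms(4) by (simp add: val_gt_mult_of_rat)
    qed (simp add: val_gt_def)
  qed
  then show ?thesis using val_add_dominant[OF lead(1)] sum lead(2) by simp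
qed

end

section \<open>Singular points as valued affine relations\<close>

definition trop_term :: "(int^'n \<Rightarrow> real) \<Rightarrow> real^'n \<Rightarrow> int^'n \<Rightarrow> real" where
  "trop_term p q i = p i + rv i \<bullet> q"

definition affine_relation :: "(int^'n) set \<Rightarrow> (int^'n \<Rightarrow> 'a::field) \<Rightarrow> bool" where
  "affine_relation A c \<longleftrightarrow> (\<Sum>k\<in>A. c k) = 0 \<and> (\<forall>j. (\<Sum>k\<in>A. c k * of_int (k $ j)) = 0)"

lemma affine_relation_sum:
  "(\<And>i. i \<in> I \<Longrightarrow> affine_relation A (c i)) \<Longrightarrow> affine_relation A (\<lambda>k. \<Sum>i\<in>I. c i k)"
  unfolding affine_relation_def sum_distrib_right
  by (subst (1 2) sum.swap) simp

lemma affine_relation_mult: "affine_relation A c \<Longrightarrow> affine_relation A (\<lambda>k. e * c k)"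
  unfolding affine_relation_def by (simp add: sum_distrib_left[symmetric] mult.assoc)

lemma affine_relation_of_rat:
  assumes "affine_relation A c"
  shows "affine_relation A (\<lambda>k. of_rat (c k) :: 'a::field_char_0)"
  unfolding affine_relation_def
proof (intro conjI allI)
  show "(\<Sum>k\<in>A. of_rat (c k)) = (0::'a)"
    using assms by (simp add: affine_relation_def flip: of_rat_sum)
  fix j
  have "(\<Sum>k\<in>A. of_rat (c k) * of_int (k $ j)) = (of_rat (\<Sum>k\<in>A. c k * of_int (k $ j)) :: 'a)"
    by (simp add: of_rat_sum of_rat_mult)
  then show "(\<Sum>k\<in>A. of_rat (c k) * of_int (k $ j)) = (0::'a)"
    using assms by (simp add: affine_relation_def)
qed

lemma mono_eval_nonzero: "(\<forall>j. b $ j \<noteq> 0) \<Longrightarrow> mono_eval b i \<noteq> 0"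
  unfolding mono_eval_def by (auto simp: prod_zero_iff)

lemma mono_eval_axis:
  assumes "b $ j \<noteq> 0"
  shows "mono_eval b i = b $ j * mono_eval b (i - axis j 1)"
proof -
  have rest: "(\<Prod>j'\<in>UNIV - {j}. b $ j' powi ((i - axis j 1) $ j')) = (\<Prod>j'\<in>UNIV - {j}. b $ j' powi (i $ j'))"
    by (rule prod.cong) (auto simp: axis_def)
  have "b $ j powi (i $ j) = b $ j * b $ j powi (i $ j - 1)"
    using power_int_add_1'[of "b $ j" "i $ j - 1"] assms by simp
  then show ?thesis
    unfolding mono_eval_def prod.remove[OF finite UNIV_I, of _ j] rest
    by (simp add: axis_def)
qed

context ultrametric_valuation
begin

lemma val_mono_eval:
  assumes "\<forall>j. b $ j \<noteq> 0 \<and> val (b $ j) = q $ j"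
  shows "val (mono_eval b i) = rv i \<bullet> q"
  using assms unfolding mono_eval_def
  by (simp add: val_prod val_power_int inner_vec_def rv_def)

definition valued_relation :: "(int^'n) set \<Rightarrow> (int^'n \<Rightarrow> real) \<Rightarrow> bool" where
  "valued_relation A w \<longleftrightarrow> (\<exists>c. (\<forall>k\<in>A. c k \<noteq> 0 \<and> val (c k) = w k) \<and> affine_relation A c)"

text \<open>With \<open>c\<^sub>k = a\<^sub>k b\<^sup>k\<close> one has \<open>F(b) = \<Sum> c\<^sub>k\<close> and \<open>b\<^sub>j \<partial>\<^sub>jF(b) = \<Sum> c\<^sub>k k\<^sub>j\<close>.\<close>
lemma valued_relation_if_singular_point:
  assumes "singular_point val A p q"
  shows "valued_relation A (trop_term p q)"
proof -
  obtain a b where a: "\<forall>i\<in>A. a i \<noteq> 0 \<and> val (a i) = p i"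
    and b: "\<forall>j. b $ j \<noteq> 0 \<and> val (b $ j) = q $ j"
    and F: "(\<Sum>i\<in>A. a i * mono_eval b i) = 0"
    and dF: "\<forall>j. (\<Sum>i\<in>A. a i * of_int (i $ j) * mono_eval b (i - axis j 1)) = 0"
    using assms unfolding singular_point_def by blast
  define c where "c i = a i * mono_eval b i" for i
  have bj: "b $ j \<noteq> 0" for j using b by blast
  have "\<forall>k\<in>A. c k \<noteq> 0 \<and> val (c k) = trop_term p q k"
    using a mono_eval_nonzero[of b] bj val_mono_eval[OF b]
    by (simp add: c_def val_mult trop_term_def)
  moreover have "affine_relation A c"
    unfolding affine_relation_def
  proof (intro conjI allI)
    show "(\<Sum>k\<in>A. c k) = 0" using F by (simp add: c_def)
    fix j
    have summand: "c k * of_int (k $ j) = b $ j * (a k * of_int (k $ j) * mono_eval b (k - axis j 1))" for k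
      unfolding c_def mono_eval_axis[OF bj, of k j] by (simp only: mult_ac)
    have "(\<Sum>k\<in>A. c k * of_int (k $ j))
        = b $ j * (\<Sum>k\<in>A. a k * of_int (k $ j) * mono_eval b (k - axis j 1))"
      unfolding sum_distrib_left by (simp only: summand)
    then show "(\<Sum>k\<in>A. c k * of_int (k $ j)) = 0" using dF by simp
  qed
  ultimately show ?thesis unfolding valued_relation_def by blast
qed

text \<open>Since \<open>val\<close> is onto \<open>\<real>\<close>, a point \<open>b\<close> with \<open>val b = q\<close> exists and \<open>a\<^sub>k = c\<^sub>k / b\<^sup>k\<close>.\<close>
lemma singular_point_if_valued_relation:
  fixes A :: "(int^'n) set"
  assumes "q \<in> trop_hypersurface A p" "valued_relation A (trop_term p q)"
  shows "singular_point val A p q"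
proof -
  obtain c where c: "\<forall>k\<in>A. c k \<noteq> 0 \<and> val (c k) = trop_term p q k" and rel: "affine_relation A c"
    using assms(2) unfolding valued_relation_def by blast
  define b :: "'k^'n" where "b = (\<chi> j. SOME x. x \<noteq> 0 \<and> val x = q $ j)"
  have b: "\<forall>j. b $ j \<noteq> 0 \<and> val (b $ j) = q $ j"
    unfolding b_def using someI_ex[OF val_surj] by auto
  have bj: "b $ j \<noteq> 0" for j using b by blast
  have me: "mono_eval b i \<noteq> 0" for i using mono_eval_nonzero bj by blast
  define a where "a i = c i / mono_eval b i" for i
  have ab: "a i * mono_eval b i = c i" for i
    using me by (simp add: a_def)
  have "\<forall>i\<in>A. a i \<noteq> 0 \<and> val (a i) = p i"
    using c me val_mono_eval[OF b] by (simp add: a_def val_divide trop_term_def)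
  moreover have "(\<Sum>i\<in>A. a i * mono_eval b i) = 0"
    using rel by (simp add: ab affine_relation_def)
  moreover have "(\<Sum>i\<in>A. a i * of_int (i $ j) * mono_eval b (i - axis j 1)) = 0" for j
  proof -
    have summand: "a i * of_int (i $ j) * mono_eval b (i - axis j 1) = c i * of_int (i $ j) / b $ j" for i
      using ab[of i] bj[of j] unfolding mono_eval_axis[OF bj, of i j] by (simp add: field_simps)
    have "(\<Sum>i\<in>A. a i * of_int (i $ j) * mono_eval b (i - axis j 1))
        = (\<Sum>i\<in>A. c i * of_int (i $ j)) / b $ j"
      unfolding sum_divide_distrib by (simp only: summand)
    then show ?thesis using rel by (simp add: affine_relation_def)
  qed
  ultimately show ?thesis
    unfolding singular_point_def using assms(1) b by blast
qed

end

section \<open>Flags\<close>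

lemma argmin_set_iff: "i \<in> argmin_set p q S \<longleftrightarrow> i \<in> S \<and> (\<forall>k\<in>S. trop_term p q i \<le> trop_term p q k)"
  by (simp add: argmin_set_def trop_term_def)

lemma argmin_set_empty [simp]: "argmin_set p q {} = {}"
  by (simp add: argmin_set_def)

lemma argmin_set_subset: "argmin_set p q S \<subseteq> S"
  by (auto simp: argmin_set_def)

lemma argmin_set_nonempty:
  assumes "finite S" "S \<noteq> {}"
  shows "argmin_set p q S \<noteq> {}"
proof -
  have "Min (trop_term p q ` S) \<in> trop_term p q ` S" using assms by simp
  then obtain i where "i \<in> S" "trop_term p q i = Min (trop_term p q ` S)" by auto
  then have "i \<in> argmin_set p q S"
    using assms by (simp add: argmin_set_iff)
  then show ?thesis by blast
qed

lemma argmin_set_less: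
  assumes "i \<in> argmin_set p q S" "k \<in> S - argmin_set p q S"
  shows "trop_term p q i < trop_term p q k"
proof -
  have "trop_term p q i \<le> trop_term p q k" using assms by (simp add: argmin_set_iff)
  moreover have "trop_term p q i \<noteq> trop_term p q k"
    using assms by (auto simp: argmin_set_iff)
  ultimately show ?thesis by simp
qed

lemma argmin_set_eq_iff:
  assumes "M \<noteq> {}" "M \<subseteq> S"
  shows "argmin_set p q S = M \<longleftrightarrow>
    (\<forall>i\<in>M. \<forall>k\<in>M. trop_term p q i = trop_term p q k) \<and>
    (\<forall>i\<in>M. \<forall>k\<in>S - M. trop_term p q i < trop_term p q k)"
    (is "_ \<longleftrightarrow> ?eq \<and> ?less")
proof
  assume M: "argmin_set p q S = M"
  then have "?eq" by (auto simp: argmin_set_iff intro: antisym)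
  moreover have "?less"
    using M unfolding argmin_set_iff set_eq_iff by (metis Diff_iff order_le_less)
  ultimately show "?eq \<and> ?less" ..
next
  assume "?eq \<and> ?less"
  moreover obtain m where "m \<in> M" using assms(1) by blast
  ultimately show "argmin_set p q S = M"
    using assms(2) unfolding argmin_set_iff set_eq_iff
    by (metis Diff_iff less_le_not_le order_refl subsetD)
qed

lemma sigma_eq_argmin_set:
  assumes "finite A"
  shows "sigma A p q = argmin_set p q A"
proof -
  have "p i + rv i \<bullet> q = Min ((\<lambda>i. p i + rv i \<bullet> q) ` A)
      \<longleftrightarrow> (\<forall>k\<in>A. p i + rv i \<bullet> q \<le> p k + rv k \<bullet> q)" if "i \<in> A" for i
    using assms that by (auto intro: antisym Min_le Min.boundedI)
  then show ?thesis by (auto simp: sigma_def argmin_set_def trop_val_def)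
qed

definition aff_span :: "(int^'n) set \<Rightarrow> (int^'n) set" where
  "aff_span F = {i. rv i \<in> affine hull (rv ` F)}"

lemma aff_span_mono: "F \<subseteq> G \<Longrightarrow> aff_span F \<subseteq> aff_span G"
  unfolding aff_span_def by (auto dest: hull_mono[OF image_mono])

lemma subset_aff_span: "F \<subseteq> aff_span F"
  unfolding aff_span_def by (auto intro: hull_inc)

lemma aff_span_empty [simp]: "aff_span {} = {}"
  by (simp add: aff_span_def)

text \<open>\<open>flag A p q (Suc l)\<close> is the paper's \<open>F\<^sub>l(q)\<close> (see \<open>flag_seq_eq_flag\<close>). Starting from an
  empty stage yields \<open>F\<^sub>0(q) = \<sigma>\<^sub>q\<close> by the same step, and the dimension test of \<open>flag_seq\<close> is
  dropped: from a full-dimensional stage the step adds nothing.\<close>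
fun flag :: "(int^'n) set \<Rightarrow> (int^'n \<Rightarrow> real) \<Rightarrow> real^'n \<Rightarrow> nat \<Rightarrow> (int^'n) set" where
  "flag A p q 0 = {}"
| "flag A p q (Suc l) = flag A p q l \<union> argmin_set p q (A - aff_span (flag A p q l))"

lemma flag_subset: "flag A p q l \<subseteq> A"
proof (induction l)
  case (Suc l)
  then show ?case using argmin_set_subset[of p q "A - aff_span (flag A p q l)"] by auto
qed simp

lemma flag_mono: "l \<le> l' \<Longrightarrow> flag A p q l \<subseteq> flag A p q l'"
  by (induction l' rule: dec_induct) auto

lemma flag_seq_eq_flag:
  fixes A :: "(int^'n) set"
  assumes "finite A"
  shows "flag_seq A p q l = flag A p q (Suc l)"
proof (induction l)
  case 0
  show ?case using sigma_eq_argmin_set[OF assms] by simp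
next
  case (Suc l)
  let ?F = "flag A p q (Suc l)"
  have "aff_span ?F = UNIV" if "\<not> aff_dim (rv ` ?F) < int CARD('n)"
    using that aff_dim_le_DIM[of "rv ` ?F"] aff_dim_eq_full[of "rv ` ?F"]
    by (simp add: aff_span_def)
  then show ?case
    using Suc by (simp only: flag_seq.simps flag.simps(2)[of _ _ _ "Suc l"] aff_span_def) auto
qed

lemma flag_term_less:
  "j \<in> flag A p q l \<Longrightarrow> k \<in> A - aff_span (flag A p q l) \<Longrightarrow> trop_term p q j < trop_term p q k"
proof (induction l arbitrary: j)
  case (Suc l)
  have k: "k \<in> A - aff_span (flag A p q l)"
    using Suc.prems(2) aff_span_mono[of "flag A p q l" "flag A p q (Suc l)"] by auto
  show ?case
  proof (cases "j \<in> flag A p q l")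
    case False
    then have j: "j \<in> argmin_set p q (A - aff_span (flag A p q l))" using Suc.prems(1) by simp
    moreover have "k \<notin> argmin_set p q (A - aff_span (flag A p q l))"
      using Suc.prems(2) subset_aff_span[of "flag A p q (Suc l)"] by auto
    ultimately show ?thesis using k argmin_set_less by blast
  qed (use Suc.IH k in blast)
qed simp

lemma flag_term_le:
  "j \<in> flag A p q (Suc l) \<Longrightarrow> k \<in> A - aff_span (flag A p q l) \<Longrightarrow> trop_term p q j \<le> trop_term p q k"
  using flag_term_less[of j A p q l k] by (auto simp: argmin_set_iff)

lemma flag_spans:
  assumes "finite A"
  shows "\<exists>N. A \<subseteq> aff_span (flag A p q N)"
proof (rule ccontr)
  assume "\<nexists>N. A \<subseteq> aff_span (flag A p q N)"
  then have "l \<le> card (flag A p q l)" for l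
  proof (induction l)
    case (Suc l)
    have "A - aff_span (flag A p q l) \<noteq> {}" using Suc.prems by blast
    then obtain i where i: "i \<in> argmin_set p q (A - aff_span (flag A p q l))"
      using argmin_set_nonempty[of "A - aff_span (flag A p q l)"] assms by blast
    then have "i \<notin> flag A p q l" using argmin_set_subset subset_aff_span by blast
    moreover have "insert i (flag A p q l) \<subseteq> flag A p q (Suc l)" using i by auto
    ultimately have "Suc (card (flag A p q l)) \<le> card (flag A p q (Suc l))"
      using card_mono[OF finite_subset[OF flag_subset assms]] card_insert_disjoint
        finite_subset[OF flag_subset assms] by metis
    then show ?case using Suc by simp
  qed simp
  from this[of "Suc (card A)"] show False
    using card_mono[OF assms flag_subset[of A p q "Suc (card A)"]] by simp
qed

lemma flag_level:
  assumes "finite A" "i \<in> A"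
  obtains l where "i \<notin> aff_span (flag A p q l)" "i \<in> aff_span (flag A p q (Suc l))"
proof -
  obtain N where "i \<in> aff_span (flag A p q N)" using flag_spans[OF assms(1)] assms(2) by blast
  then have "\<exists>l. i \<notin> aff_span (flag A p q l) \<and> i \<in> aff_span (flag A p q (Suc l))"
  proof (induction N)
    case (Suc N)
    then show ?case by (cases "i \<in> aff_span (flag A p q N)") blast+
  qed simp
  then show thesis using that by blast
qed

lemma flag_eq_if_argmin_set_eq:
  "(\<And>S. S \<subseteq> A \<Longrightarrow> argmin_set p q S = argmin_set p q' S) \<Longrightarrow> flag A p q l = flag A p q' l"
  by (induction l) auto

lemma flag_eq_iff_flag_seq_eq:
  assumes "finite A"
  shows "flag A p q = flag A p q' \<longleftrightarrow> flag_seq A p q = flag_seq A p q'"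
proof -
  have "flag A p q l = flag A p q' l" if "flag_seq A p q = flag_seq A p q'" for l
    using that by (cases l) (simp_all add: flag_seq_eq_flag[OF assms, symmetric] del: flag.simps(2))
  then show ?thesis by (auto simp: flag_seq_eq_flag[OF assms])
qed

lemma flag_eq_iff_argmin_set_eq:
  "flag A p q = flag A p q' \<longleftrightarrow>
    (\<forall>l. argmin_set p q (A - aff_span (flag A p q' l)) = argmin_set p q' (A - aff_span (flag A p q' l)))"
    (is "_ \<longleftrightarrow> (\<forall>l. ?step l)")
proof
  assume eq: "flag A p q = flag A p q'"
  show "\<forall>l. ?step l"
  proof
    fix l
    have "flag A p q' l \<union> argmin_set p q (A - aff_span (flag A p q' l))
        = flag A p q' l \<union> argmin_set p q' (A - aff_span (flag A p q' l))"
      using fun_cong[OF eq, of "Suc l"] fun_cong[OF eq, of l] by simp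
    moreover have "argmin_set p q'' (A - aff_span (flag A p q' l)) \<inter> flag A p q' l = {}" for q''
      using argmin_set_subset subset_aff_span by blast
    ultimately show "?step l" by blast
  qed
next
  assume "\<forall>l. ?step l"
  then have "flag A p q l = flag A p q' l" for l by (induction l) auto
  then show "flag A p q = flag A p q'" by blast
qed

section \<open>Rational affine dependence of lattice points\<close>

text \<open>Relations must have coefficients in \<open>'k\<close>, which contains \<open>\<rat>\<close> but not \<open>\<real>\<close>, so real affine
  dependencies among lattice points have to be made rational.\<close>

lemma exists_dual_vector:
  fixes u :: "'a::field^'n"
  assumes "u \<notin> vec.span S"
  obtains \<phi> :: "'a^'n" where "\<forall>s\<in>S. (\<Sum>j\<in>UNIV. \<phi> $ j * s $ j) = 0" "(\<Sum>j\<in>UNIV. \<phi> $ j * u $ j) \<noteq> 0"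
proof -
  obtain B where B: "B \<subseteq> S" "vec.independent B" "S \<subseteq> vec.span B"
    by (rule vec.maximal_independent_subset)
  have uB: "u \<notin> vec.span B" using assms vec.span_mono[OF B(1)] by blast
  then have "u \<notin> B" using vec.span_base by blast
  obtain j0 :: 'n where True by simp
  obtain g where g: "Vector_Spaces.linear (*s) (*s) g"
    and gB: "\<forall>x\<in>insert u B. g x = (if x = u then axis j0 1 else 0)"
    using vec.linear_independent_extend[OF vec.independent_insertI[OF uB B(2)],
        of "\<lambda>x. if x = u then axis j0 1 else 0"] by blast
  have kernel: "g x = 0" if "x \<in> vec.span B" for x
  proof (rule vec.span_induct[OF that vec.linear_subspace_kernel[OF g]])
    show "g y = 0" if "y \<in> B" for y using that gB \<open>u \<notin> B\<close> by auto
  qed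
  have form: "(\<Sum>j\<in>UNIV. (\<chi> j. g (axis j 1) $ j0) $ j * x $ j) = g x $ j0" for x
  proof -
    have "g x = g (\<Sum>j\<in>UNIV. x $ j *s axis j 1)" by (simp only: basis_expansion)
    also have "\<dots> = (\<Sum>j\<in>UNIV. x $ j *s g (axis j 1))"
      by (simp add: vec.linear_sum[OF g] vec.linear_scale[OF g])
    finally show ?thesis by (simp add: sum_component mult.commute)
  qed
  show thesis
  proof (rule that)
    show "\<forall>s\<in>S. (\<Sum>j\<in>UNIV. (\<chi> j. g (axis j 1) $ j0) $ j * s $ j) = 0"
      using form kernel B(3) by auto
    show "(\<Sum>j\<in>UNIV. (\<chi> j. g (axis j 1) $ j0) $ j * u $ j) \<noteq> 0"
      using form gB by simp
  qed
qed

definition rat_form :: "rat^'n \<Rightarrow> int^'n \<Rightarrow> rat" where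
  "rat_form \<phi> k = (\<Sum>j\<in>UNIV. \<phi> $ j * of_int (k $ j))"

lemma rat_form_separating_if_no_rat_combination:
  fixes P :: "(int^'n) set"
  assumes "finite P" "f0 \<in> P"
    and "\<nexists>\<mu> :: int^'n \<Rightarrow> rat. sum \<mu> P = 1 \<and> (\<forall>j. (\<Sum>v\<in>P. \<mu> v * of_int (v $ j)) = of_int (k $ j))"
  shows "\<exists>\<phi>. (\<forall>v\<in>P. rat_form \<phi> v = rat_form \<phi> f0) \<and> rat_form \<phi> k \<noteq> rat_form \<phi> f0"
proof -
  define d :: "int^'n \<Rightarrow> rat^'n" where "d v = (\<chi> j. of_int (v $ j) - of_int (f0 $ j))" for v
  have form_d: "(\<Sum>j\<in>UNIV. \<phi> $ j * d v $ j) = rat_form \<phi> v - rat_form \<phi> f0" for \<phi> v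
    by (simp add: d_def rat_form_def right_diff_distrib sum_subtractf)
  have "d k \<notin> vec.span (d ` P)"
  proof
    assume "d k \<in> vec.span (d ` P)"
    moreover have "inj_on d P" by (rule inj_onI) (simp add: d_def vec_eq_iff)
    ultimately obtain a where a: "d k = (\<Sum>v\<in>P. a v *s d v)"
      using assms(1) by (auto simp: vec.span_finite sum.reindex)
    define \<mu> where "\<mu> v = a v + (if v = f0 then 1 - sum a P else 0)" for v
    have "sum \<mu> P = 1"
      using assms(1,2) by (simp add: \<mu>_def sum.distrib)
    moreover have "(\<Sum>v\<in>P. \<mu> v * of_int (v $ j)) = of_int (k $ j)" for j
    proof -
      have "of_int (k $ j) - of_int (f0 $ j) = (\<Sum>v\<in>P. a v * (of_int (v $ j) - of_int (f0 $ j)))"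
        using arg_cong[OF a, of "\<lambda>x. x $ j"] by (simp add: d_def sum_component)
      then have k: "of_int (k $ j) = (\<Sum>v\<in>P. a v * of_int (v $ j)) + (1 - sum a P) * of_int (f0 $ j)"
        by (simp add: right_diff_distrib sum_subtractf sum_distrib_right[symmetric] algebra_simps)
      have "\<mu> v * of_int (v $ j) = a v * of_int (v $ j) + (if v = f0 then (1 - sum a P) * of_int (f0 $ j) else 0)" for v
        by (simp add: \<mu>_def ring_distribs)
      then show ?thesis using assms(1,2) k by (simp add: sum.distrib)
    qed
    ultimately show False using assms(3) by blast
  qed
  then obtain \<phi> where "\<forall>v\<in>P. rat_form \<phi> v - rat_form \<phi> f0 = 0" "rat_form \<phi> k - rat_form \<phi> f0 \<noteq> 0"
    by (rule exists_dual_vector) (auto simp: form_d)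
  then show ?thesis by auto
qed

lemma in_affine_hull_if_rat_combination:
  fixes P :: "(int^'n) set" and \<mu> :: "int^'n \<Rightarrow> rat"
  assumes "finite P" "sum \<mu> P = 1" "\<forall>j. (\<Sum>v\<in>P. \<mu> v * of_int (v $ j)) = of_int (k $ j)"
  shows "rv k \<in> affine hull (rv ` P)"
proof -
  have inj: "inj_on rv P" by (rule inj_onI) (simp add: rv_def vec_eq_iff)
  define u where "u y = real_of_rat (\<mu> (inv_into P rv y))" for y
  have "sum u (rv ` P) = 1"
    using assms(2) inj by (simp add: sum.reindex u_def flip: of_rat_sum)
  moreover have "(\<Sum>y\<in>rv ` P. u y *\<^sub>R y) $ j = rv k $ j" for j
  proof -
    have "(\<Sum>y\<in>rv ` P. u y *\<^sub>R y) = (\<Sum>v\<in>P. real_of_rat (\<mu> v) *\<^sub>R rv v)"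
      using inj by (simp add: sum.reindex u_def)
    then have "(\<Sum>y\<in>rv ` P. u y *\<^sub>R y) $ j = real_of_rat (\<Sum>v\<in>P. \<mu> v * of_int (v $ j))"
      by (simp add: sum_component rv_def of_rat_sum of_rat_mult)
    then show ?thesis using assms(3) by (simp add: rv_def)
  qed
  ultimately show ?thesis using assms(1) by (auto simp: affine_hull_finite vec_eq_iff)
qed

lemma rat_form_eq_on_affine_hull:
  fixes \<phi> :: "rat^'n"
  assumes "\<forall>v\<in>P. rat_form \<phi> v = c" "rv k \<in> affine hull (rv ` P)"
  shows "rat_form \<phi> k = c"
proof -
  define a :: "real^'n" where "a = (\<chi> j. real_of_rat (\<phi> $ j))"
  have a: "a \<bullet> rv v = real_of_rat (rat_form \<phi> v)" for v
    by (simp add: a_def rv_def rat_form_def inner_vec_def of_rat_sum of_rat_mult)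
  have "affine hull (rv ` P) \<subseteq> {x. a \<bullet> x = real_of_rat c}"
    using assms(1) a by (intro hull_minimal affine_hyperplane) auto
  then show ?thesis using assms(2) a by auto
qed

lemma rat_combination_if_in_affine_hull:
  fixes P :: "(int^'n) set"
  assumes "finite P" "rv k \<in> affine hull (rv ` P)"
  shows "\<exists>\<mu> :: int^'n \<Rightarrow> rat. sum \<mu> P = 1 \<and> (\<forall>j. (\<Sum>v\<in>P. \<mu> v * of_int (v $ j)) = of_int (k $ j))"
proof (rule ccontr)
  assume none: "\<not> ?thesis"
  have "P \<noteq> {}" using assms(2) by auto
  then obtain f0 where "f0 \<in> P" by blast
  then obtain \<phi> where "\<forall>v\<in>P. rat_form \<phi> v = rat_form \<phi> f0" "rat_form \<phi> k \<noteq> rat_form \<phi> f0"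
    using rat_form_separating_if_no_rat_combination[OF assms(1) _ none] by blast
  then show False using rat_form_eq_on_affine_hull assms(2) by blast
qed

lemma exists_rat_form_separating:
  fixes P :: "(int^'n) set"
  assumes "finite P" "rv k \<notin> affine hull (rv ` P)"
  shows "\<exists>\<phi> c. (\<forall>i. rv i \<in> affine hull (rv ` P) \<longrightarrow> rat_form \<phi> i = c) \<and> rat_form \<phi> k \<noteq> c"
proof (cases "P = {}")
  case True
  then show ?thesis by (intro exI[of _ 0] exI[of _ 1]) (simp add: rat_form_def)
next
  case False
  then obtain f0 where "f0 \<in> P" by blast
  moreover have "\<nexists>\<mu> :: int^'n \<Rightarrow> rat. sum \<mu> P = 1 \<and> (\<forall>j. (\<Sum>v\<in>P. \<mu> v * of_int (v $ j)) = of_int (k $ j))"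
    using in_affine_hull_if_rat_combination[OF assms(1)] assms(2) by blast
  ultimately obtain \<phi> where "\<forall>v\<in>P. rat_form \<phi> v = rat_form \<phi> f0" "rat_form \<phi> k \<noteq> rat_form \<phi> f0"
    using rat_form_separating_if_no_rat_combination[OF assms(1)] by blast
  then show ?thesis using rat_form_eq_on_affine_hull by blast
qed

section \<open>The no-coloop criterion\<close>

lemma exists_generic_combination:
  fixes \<rho> :: "'i \<Rightarrow> 'i \<Rightarrow> 'a::field_char_0"
  assumes "finite T" "\<forall>i\<in>T. \<rho> i i \<noteq> 0"
  shows "\<exists>t. \<forall>k\<in>T. (\<Sum>i\<in>T. t i * \<rho> i k) \<noteq> 0"
  using assms
proof (induction T rule: finite_induct)
  case (insert x T)
  have "\<forall>i\<in>T. \<rho> i i \<noteq> 0" using insert.prems by simp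
  then obtain t where t: "\<forall>k\<in>T. (\<Sum>i\<in>T. t i * \<rho> i k) \<noteq> 0" using insert.IH by blast
  have "finite ((\<lambda>k. - (\<Sum>i\<in>T. t i * \<rho> i k) / \<rho> x k) ` insert x T)"
    using insert.hyps(1) by simp
  then obtain s where s: "s \<notin> (\<lambda>k. - (\<Sum>i\<in>T. t i * \<rho> i k) / \<rho> x k) ` insert x T"
    using ex_new_if_finite[OF infinite_UNIV_char_0] by blast
  show ?case
  proof (intro exI ballI)
    fix k assume k: "k \<in> insert x T"
    have "(\<Sum>i\<in>T. (t(x := s)) i * \<rho> i k) = (\<Sum>i\<in>T. t i * \<rho> i k)"
      using insert.hyps(2) by (intro sum.cong) auto
    moreover have "s * \<rho> x k + (\<Sum>i\<in>T. t i * \<rho> i k) \<noteq> 0"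
    proof (cases "\<rho> x k = 0")
      case True
      then show ?thesis using k t insert.prems by auto
    next
      case False
      show ?thesis
      proof
        assume "s * \<rho> x k + (\<Sum>i\<in>T. t i * \<rho> i k) = 0"
        then have "s * \<rho> x k = - (\<Sum>i\<in>T. t i * \<rho> i k)"
          by (simp add: eq_neg_iff_add_eq_0)
        then have "s = - (\<Sum>i\<in>T. t i * \<rho> i k) / \<rho> x k"
          using False by (simp add: field_simps)
        then show False using s k by blast
      qed
    qed
    ultimately show "(\<Sum>i\<in>insert x T. (t(x := s)) i * \<rho> i k) \<noteq> 0"
      using insert.hyps by simp
  qed
qed simp

lemma affine_relation_rat_form:
  assumes "affine_relation A c"
  shows "(\<Sum>k\<in>A. c k * of_rat (rat_form \<phi> k - a)) = 0"
proof -
  have summand: "c k * of_rat (rat_form \<phi> k - a)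
      = (\<Sum>j\<in>UNIV. of_rat (\<phi> $ j) * (c k * of_int (k $ j))) - of_rat a * c k" for k
    by (simp add: rat_form_def of_rat_diff of_rat_sum of_rat_mult sum_distrib_left right_diff_distrib mult_ac)
  have "(\<Sum>k\<in>A. c k * of_rat (rat_form \<phi> k - a))
      = (\<Sum>k\<in>A. \<Sum>j\<in>UNIV. of_rat (\<phi> $ j) * (c k * of_int (k $ j))) - of_rat a * (\<Sum>k\<in>A. c k)"
    by (simp only: summand sum_subtractf sum_distrib_left)
  also have "\<dots> = (\<Sum>j\<in>UNIV. of_rat (\<phi> $ j) * (\<Sum>k\<in>A. c k * of_int (k $ j))) - of_rat a * (\<Sum>k\<in>A. c k)"
    by (subst sum.swap) (simp only: sum_distrib_left)
  also have "\<dots> = 0" using assms by (simp add: affine_relation_def)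
  finally show ?thesis .
qed

lemma affine_relation_if_in_affine_hull:
  fixes A P :: "(int^'n) set"
  assumes "finite A" "i \<in> A" "P \<subseteq> A" "i \<notin> P" "rv i \<in> affine hull (rv ` P)"
  shows "\<exists>\<rho> :: int^'n \<Rightarrow> rat. affine_relation A \<rho> \<and> \<rho> i = 1 \<and> (\<forall>k. \<rho> k \<noteq> 0 \<longrightarrow> k = i \<or> k \<in> P)"
proof -
  obtain \<mu> :: "int^'n \<Rightarrow> rat" where \<mu>: "sum \<mu> P = 1" "\<forall>j. (\<Sum>v\<in>P. \<mu> v * of_int (v $ j)) = of_int (i $ j)"
    using rat_combination_if_in_affine_hull[OF finite_subset[OF assms(3,1)] assms(5)] by blast
  define \<rho> where "\<rho> k = (if k = i then 1 else 0) - (if k \<in> P then \<mu> k else 0)" for k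
  have comb: "(\<Sum>k\<in>A. \<rho> k * y k) = y i - (\<Sum>v\<in>P. \<mu> v * y v)" for y
  proof -
    have "\<rho> k * y k = (if k = i then y i else 0) - (if k \<in> P then \<mu> k * y k else 0)" for k
      by (simp add: \<rho>_def left_diff_distrib)
    then have "(\<Sum>k\<in>A. \<rho> k * y k) = y i - (\<Sum>v\<in>A \<inter> P. \<mu> v * y v)"
      using assms(1,2) by (simp add: sum_subtractf sum.inter_restrict)
    then show ?thesis using Int_absorb1[OF assms(3)] by (simp add: Int_commute)
  qed
  have "affine_relation A \<rho>"
    unfolding affine_relation_def using \<mu> comb[of "\<lambda>_. 1"] comb by simp
  then show ?thesis using assms(4) by (intro exI[of _ \<rho>]) (auto simp: \<rho>_def)
qed

definition no_coloop :: "(int^'n) set \<Rightarrow> (int^'n \<Rightarrow> real) \<Rightarrow> real^'n \<Rightarrow> bool" where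
  "no_coloop A p q \<longleftrightarrow> (\<forall>l. \<forall>i \<in> flag A p q (Suc l) - flag A p q l.
      rv i \<in> affine hull (rv ` (flag A p q (Suc l) - {i})))"

lemma lower_relation_if_no_coloop:
  fixes A :: "(int^'n) set"
  assumes "finite A" "no_coloop A p q" "i \<in> A"
  shows "\<exists>\<rho> :: int^'n \<Rightarrow> rat. affine_relation A \<rho> \<and> \<rho> i = 1 \<and>
    (\<forall>k\<in>A. \<rho> k \<noteq> 0 \<longrightarrow> trop_term p q k \<le> trop_term p q i)"
proof -
  obtain l where l: "i \<notin> aff_span (flag A p q l)" "i \<in> aff_span (flag A p q (Suc l))"
    using flag_level[OF assms(1,3)] .
  let ?P = "flag A p q (Suc l) - {i}"
  have hull: "rv i \<in> affine hull (rv ` ?P)"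
  proof (cases "i \<in> flag A p q (Suc l)")
    case True
    then have "i \<in> flag A p q (Suc l) - flag A p q l" using l(1) subset_aff_span by blast
    then show ?thesis using assms(2) unfolding no_coloop_def by blast
  qed (use l(2) in \<open>simp add: aff_span_def\<close>)
  have PA: "?P \<subseteq> A" using flag_subset by blast
  obtain \<rho> :: "int^'n \<Rightarrow> rat" where \<rho>: "affine_relation A \<rho>" "\<rho> i = 1" "\<forall>k. \<rho> k \<noteq> 0 \<longrightarrow> k = i \<or> k \<in> ?P"
    using affine_relation_if_in_affine_hull[OF assms(1,3) PA _ hull] by blast
  moreover have "trop_term p q k \<le> trop_term p q i" if "k \<in> ?P" for k
    using flag_term_le[of k A p q l i] that l(1) assms(3) by blast
  ultimately show ?thesis by blast
qed

context ultrametric_valuation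
begin

text \<open>A coloop \<open>i\<close> would admit a rational affine form vanishing on the rest of its stage but
  not at \<open>i\<close>; pairing it with the relation leaves \<open>c\<^sub>i\<close> as the unique term of least valuation.\<close>
lemma no_coloop_if_valued_relation:
  fixes A :: "(int^'n) set"
  assumes "finite A" "valued_relation A (trop_term p q)"
  shows "no_coloop A p q"
  unfolding no_coloop_def
proof (intro allI ballI)
  obtain c where c: "\<forall>k\<in>A. c k \<noteq> 0 \<and> val (c k) = trop_term p q k" and rel: "affine_relation A c"
    using assms(2) unfolding valued_relation_def by blast
  fix l i assume i: "i \<in> flag A p q (Suc l) - flag A p q l"
  let ?P = "flag A p q (Suc l) - {i}"
  let ?S = "A - aff_span (flag A p q l)"
  have iA: "i \<in> A" using i flag_subset by blast
  have i_min: "i \<in> argmin_set p q ?S" using i by auto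
  show "rv i \<in> affine hull (rv ` ?P)"
  proof (rule ccontr)
    assume out: "rv i \<notin> affine hull (rv ` ?P)"
    have "finite ?P" using finite_subset[OF flag_subset assms(1)] by blast
    then obtain \<phi> a where \<phi>: "\<forall>k. rv k \<in> affine hull (rv ` ?P) \<longrightarrow> rat_form \<phi> k = a" "rat_form \<phi> i \<noteq> a"
      using exists_rat_form_separating[OF _ out] by blast
    define f where "f k = c k * of_rat (rat_form \<phi> k - a)" for k
    have fi: "f i \<noteq> 0 \<and> val (f i) = trop_term p q i"
      using \<phi>(2) c iA by (simp add: f_def val_mult_of_rat)
    have "val_gt (val (f i)) (f k)" if "k \<in> A - {i}" for k
    proof (cases "rat_form \<phi> k = a")
      case False
      then have "rv k \<notin> affine hull (rv ` ?P)" using \<phi>(1) by blast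
      moreover have "flag A p q l \<subseteq> ?P" using i flag_mono[of l "Suc l"] by auto
      ultimately have "k \<notin> flag A p q (Suc l)" "k \<notin> aff_span (flag A p q l)"
        using that hull_inc[of "rv k" "rv ` ?P"] aff_span_mono[of "flag A p q l" ?P]
        by (auto simp: aff_span_def)
      then have "k \<in> ?S - argmin_set p q ?S" using that by auto
      then have "trop_term p q i < trop_term p q k" by (rule argmin_set_less[OF i_min])
      then show ?thesis using fi c that by (simp add: f_def val_gt_mult_of_rat)
    qed (simp add: f_def val_gt_def)
    then have "sum f A \<noteq> 0" using sum_nonzero_if_dominant[OF assms(1) iA] fi by blast
    then show False using affine_relation_rat_form[OF rel] by (simp add: f_def)
  qed
qed

lemma valued_relation_if_lower_relations:
  fixes A :: "(int^'n) set" and w :: "int^'n \<Rightarrow> real"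
  assumes "finite A"
    and "\<forall>i\<in>A. \<exists>\<rho> :: int^'n \<Rightarrow> rat. affine_relation A \<rho> \<and> \<rho> i = 1 \<and> (\<forall>k\<in>A. \<rho> k \<noteq> 0 \<longrightarrow> w k \<le> w i)"
  shows "valued_relation A w"
proof -
  obtain \<rho> :: "int^'n \<Rightarrow> int^'n \<Rightarrow> rat"
    where \<rho>: "\<forall>i\<in>A. affine_relation A (\<rho> i) \<and> \<rho> i i = 1 \<and> (\<forall>k\<in>A. \<rho> i k \<noteq> 0 \<longrightarrow> w k \<le> w i)"
    using bchoice[OF assms(2)] by blast
  obtain t where t: "\<forall>k\<in>A. (\<Sum>i\<in>A. t i * (if w i = w k then \<rho> i k else 0)) \<noteq> 0"
    using exists_generic_combination[OF assms(1), of "\<lambda>i k. if w i = w k then \<rho> i k else 0"] \<rho> by auto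
  define e where "e r = (SOME x. x \<noteq> 0 \<and> val x = r)" for r
  have e: "\<forall>r. e r \<noteq> 0 \<and> val (e r) = r"
    unfolding e_def using someI_ex[OF val_surj] by blast
  define c where "c k = (\<Sum>i\<in>A. e (w i) * of_rat (t i * \<rho> i k))" for k
  have "affine_relation A c"
    unfolding c_def using \<rho> by (intro affine_relation_sum affine_relation_mult affine_relation_of_rat) auto
  moreover have "c k \<noteq> 0 \<and> val (c k) = w k" if k: "k \<in> A" for k
  proof -
    have low: "\<forall>i\<in>A. t i * \<rho> i k \<noteq> 0 \<longrightarrow> w k \<le> w i" using \<rho> k by simp
    have "(\<Sum>i\<in>A \<inter> {i. w i = w k}. t i * \<rho> i k) = (\<Sum>i\<in>A. t i * (if w i = w k then \<rho> i k else 0))"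
      by (auto simp: sum.inter_restrict[OF assms(1)] intro!: sum.cong)
    then have lead: "(\<Sum>i\<in>A \<inter> {i. w i = w k}. t i * \<rho> i k) \<noteq> 0" using t k by simp
    show ?thesis unfolding c_def by (rule val_sum_leading[OF assms(1) low lead e])
  qed
  ultimately show ?thesis unfolding valued_relation_def by blast
qed

lemma singular_point_iff_no_coloop:
  fixes A :: "(int^'n) set"
  assumes "finite A"
  shows "singular_point val A p q \<longleftrightarrow> q \<in> trop_hypersurface A p \<and> no_coloop A p q"
proof
  assume sing: "singular_point val A p q"
  then have "q \<in> trop_hypersurface A p" unfolding singular_point_def by blast
  moreover have "no_coloop A p q"
    using no_coloop_if_valued_relation[OF assms valued_relation_if_singular_point[OF sing]] .
  ultimately show "q \<in> trop_hypersurface A p \<and> no_coloop A p q" ..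
next
  assume "q \<in> trop_hypersurface A p \<and> no_coloop A p q"
  then show "singular_point val A p q"
    using singular_point_if_valued_relation valued_relation_if_lower_relations[OF assms]
      lower_relation_if_no_coloop[OF assms] by blast
qed

end

section \<open>Weight classes\<close>

lemma closure_halfspace_lt_nonempty:
  fixes a :: "'a::euclidean_space"
  assumes "{x. a \<bullet> x < b} \<noteq> {}"
  shows "closure {x. a \<bullet> x < b} = {x. a \<bullet> x \<le> b}"
proof (cases "a = 0")
  case True
  then show ?thesis using assms by auto
qed simp

lemma polyhedral_cell:
  fixes E S :: "('a::euclidean_space \<times> real) set"
  defines "X \<equiv> {x. (\<forall>(a, b)\<in>E. a \<bullet> x = b) \<and> (\<forall>(a, b)\<in>S. a \<bullet> x < b)}"
  assumes "finite E" "finite S" "X \<noteq> {}"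
  shows "polyhedron (closure X) \<and> rel_interior (closure X) = X"
proof -
  define H where "H = (\<Inter>(a, b)\<in>E. {x. a \<bullet> x = b})"
  define T where "T = (\<Inter>(a, b)\<in>S. {x. a \<bullet> x < b})"
  have X: "X = T \<inter> H" by (auto simp: X_def H_def T_def)
  have H: "affine H" "polyhedron H"
    using assms(2) by (auto simp: H_def intro!: affine_Inter affine_hyperplane polyhedron_hyperplane)
  have T: "open T" "convex T"
    using assms(3) by (auto simp: T_def intro!: open_Inter convex_Inter open_halfspace_lt convex_halfspace_lt)
  have "T \<noteq> {}" using X assms(4) by blast
  then have "closure T = (\<Inter>(a, b)\<in>S. closure {x. a \<bullet> x < b})"
    using closure_Inter_convex_open[of "(\<lambda>(a, b). {x. a \<bullet> x < b}) ` S"]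
    by (auto simp: T_def image_image case_prod_unfold intro: open_halfspace_lt convex_halfspace_lt)
  also have "\<dots> = (\<Inter>(a, b)\<in>S. {x. a \<bullet> x \<le> b})"
    using \<open>T \<noteq> {}\<close> by (intro INF_cong refl) (auto simp: T_def intro!: closure_halfspace_lt_nonempty)
  finally have "polyhedron (closure T)"
    using assms(3) by (auto intro!: polyhedron_halfspace_le)
  moreover have "closure X = closure T \<inter> H"
    using closure_Int_convex[of T H] T H X assms(4)
    by (simp add: rel_interior_open rel_interior_affine affine_imp_convex affine_closed closure_closed)
  moreover have "rel_interior X = X"
    using rel_interior_convex_Int_affine[of T H] T H X assms(4) by (simp add: interior_open)
  moreover have "convex X" using T H X by (simp add: convex_Int affine_imp_convex)
  ultimately show ?thesis using H(2) convex_rel_interior_closure[of X] by (metis polyhedron_Int)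
qed

definition argmin_cell :: "(int^'n \<Rightarrow> real) \<Rightarrow> (int^'n) set set \<Rightarrow> real^'n \<Rightarrow> (real^'n) set" where
  "argmin_cell p SS q0 = {q. \<forall>S\<in>SS. argmin_set p q S = argmin_set p q0 S}"

lemma argmin_cell_linear:
  fixes A :: "(int^'n) set"
  assumes "finite A" "SS \<subseteq> Pow A"
  obtains E S' where "finite E" "finite S'"
    "argmin_cell p SS q0 = {q. (\<forall>(a, b)\<in>E. a \<bullet> q = b) \<and> (\<forall>(a, b)\<in>S'. a \<bullet> q < b)}"
proof -
  define M where "M S = argmin_set p q0 S" for S
  define g where "g = (\<lambda>(i, k). (rv i - rv k, p k - p i))"
  define E where "E = g ` {(i, k). \<exists>S\<in>SS. i \<in> M S \<and> k \<in> M S}"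
  define S' where "S' = g ` {(i, k). \<exists>S\<in>SS. i \<in> M S \<and> k \<in> S - M S}"
  have sub: "{(i, k). \<exists>S\<in>SS. i \<in> M S \<and> k \<in> M S} \<subseteq> A \<times> A"
    "{(i, k). \<exists>S\<in>SS. i \<in> M S \<and> k \<in> S - M S} \<subseteq> A \<times> A"
    using assms(2) argmin_set_subset[of p q0] by (fastforce simp: M_def)+
  have "finite E" unfolding E_def
    by (rule finite_imageI, rule finite_subset[OF sub(1)]) (simp add: assms(1))
  have "finite S'" unfolding S'_def
    by (rule finite_imageI, rule finite_subset[OF sub(2)]) (simp add: assms(1))
  have mem: "q \<in> argmin_cell p SS q0 \<longleftrightarrow>
      (\<forall>(a, b)\<in>E. a \<bullet> q = b) \<and> (\<forall>(a, b)\<in>S'. a \<bullet> q < b)" for q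
  proof -
    have per_set: "argmin_set p q S = M S \<longleftrightarrow>
        (\<forall>i\<in>M S. \<forall>k\<in>M S. trop_term p q i = trop_term p q k) \<and>
        (\<forall>i\<in>M S. \<forall>k\<in>S - M S. trop_term p q i < trop_term p q k)" if "S \<in> SS" for S
    proof (cases "S = {}")
      case False
      have "finite S" using that assms by (meson PowD finite_subset subsetD)
      then show ?thesis
        unfolding M_def by (intro argmin_set_eq_iff argmin_set_nonempty[OF _ False] argmin_set_subset)
    qed (simp add: M_def)
    have ball_g: "(\<forall>(a, b)\<in>g ` R. P a b) \<longleftrightarrow> (\<forall>(i, k)\<in>R. P (rv i - rv k) (p k - p i))" for R P
      by (auto simp: g_def)
    have lin: "trop_term p q i = trop_term p q k \<longleftrightarrow> (rv i - rv k) \<bullet> q = p k - p i"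
      "trop_term p q i < trop_term p q k \<longleftrightarrow> (rv i - rv k) \<bullet> q < p k - p i" for i k
      by (auto simp: trop_term_def inner_diff_left)
    have E: "(\<forall>(a, b)\<in>E. a \<bullet> q = b) \<longleftrightarrow> (\<forall>S\<in>SS. \<forall>i\<in>M S. \<forall>k\<in>M S. trop_term p q i = trop_term p q k)"
      and S': "(\<forall>(a, b)\<in>S'. a \<bullet> q < b) \<longleftrightarrow> (\<forall>S\<in>SS. \<forall>i\<in>M S. \<forall>k\<in>S - M S. trop_term p q i < trop_term p q k)"
      unfolding E_def S'_def ball_g lin by blast+
    have "q \<in> argmin_cell p SS q0 \<longleftrightarrow> (\<forall>S\<in>SS. argmin_set p q S = M S)"
      by (simp add: argmin_cell_def M_def)
    also have "\<dots> \<longleftrightarrow> (\<forall>S\<in>SS. (\<forall>i\<in>M S. \<forall>k\<in>M S. trop_term p q i = trop_term p q k) \<and>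
        (\<forall>i\<in>M S. \<forall>k\<in>S - M S. trop_term p q i < trop_term p q k))"
      by (intro ball_cong refl per_set)
    finally show ?thesis unfolding E S' ball_conj_distrib .
  qed
  have "argmin_cell p SS q0 = {q. (\<forall>(a, b)\<in>E. a \<bullet> q = b) \<and> (\<forall>(a, b)\<in>S'. a \<bullet> q < b)}"
    by (intro set_eqI) (simp only: mem mem_Collect_eq)
  with \<open>finite E\<close> \<open>finite S'\<close> show thesis by (rule that)
qed

lemma argmin_cell_rel_interior_closure:
  fixes A :: "(int^'n) set"
  assumes "finite A" "SS \<subseteq> Pow A"
  shows "polyhedron (closure (argmin_cell p SS q0)) \<and>
    rel_interior (closure (argmin_cell p SS q0)) = argmin_cell p SS q0"
proof -
  obtain E S' where "finite E" "finite S'"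
    and eq: "argmin_cell p SS q0 = {q. (\<forall>(a, b)\<in>E. a \<bullet> q = b) \<and> (\<forall>(a, b)\<in>S'. a \<bullet> q < b)}"
    by (rule argmin_cell_linear[OF assms])
  moreover have "argmin_cell p SS q0 \<noteq> {}" by (auto simp: argmin_cell_def)
  ultimately show ?thesis unfolding eq by (intro polyhedral_cell)
qed

lemma weight_class_eq_argmin_cell:
  fixes A :: "(int^'n) set"
  assumes "finite A" "q0 \<in> trop_hypersurface A p"
  shows "weight_class A p q0 = argmin_cell p (range (\<lambda>l. A - aff_span (flag A p q0 l))) q0"
proof -
  have cell: "q \<in> argmin_cell p (range (\<lambda>l. A - aff_span (flag A p q0 l))) q0 \<longleftrightarrow> flag A p q = flag A p q0" for q
    by (simp add: argmin_cell_def flag_eq_iff_argmin_set_eq)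
  have T: "q \<in> trop_hypersurface A p" if "flag A p q = flag A p q0" for q
  proof -
    have "argmin_set p q A = argmin_set p q0 A" using fun_cong[OF that, of 1] by simp
    then show ?thesis using assms by (simp add: trop_hypersurface_def sigma_eq_argmin_set)
  qed
  show ?thesis
  proof (intro set_eqI iffI)
    fix q assume "q \<in> weight_class A p q0"
    then show "q \<in> argmin_cell p (range (\<lambda>l. A - aff_span (flag A p q0 l))) q0"
      by (simp add: weight_class_def cell flag_eq_iff_flag_seq_eq[OF assms(1)])
  next
    fix q assume "q \<in> argmin_cell p (range (\<lambda>l. A - aff_span (flag A p q0 l))) q0"
    then have "flag A p q = flag A p q0" by (simp only: cell)
    then show "q \<in> weight_class A p q0"
      using T by (simp add: weight_class_def flag_eq_iff_flag_seq_eq[OF assms(1)])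
  qed
qed

lemma weight_class_rel_interior_polyhedron:
  fixes A :: "(int^'n) set"
  assumes "finite A" "q0 \<in> trop_hypersurface A p"
  shows "\<exists>P. polyhedron P \<and> weight_class A p q0 = rel_interior P"
  using argmin_cell_rel_interior_closure[OF assms(1), of "range (\<lambda>l. A - aff_span (flag A p q0 l))" p q0]
    weight_class_eq_argmin_cell[OF assms]
  by auto

lemma weight_class_subset_rel_interior_dual_cell:
  fixes A :: "(int^'n) set"
  assumes "finite A"
  shows "weight_class A p q0 \<subseteq> rel_interior (dual_cell A p (sigma A p q0))"
proof -
  have "{q. sigma A p q = sigma A p q0} = argmin_cell p {A} q0"
    using assms by (simp add: argmin_cell_def sigma_eq_argmin_set)
  then have "rel_interior (dual_cell A p (sigma A p q0)) = {q. sigma A p q = sigma A p q0}"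
    using argmin_cell_rel_interior_closure[OF assms, of "{A}" p q0] by (simp add: dual_cell_def)
  moreover have "sigma A p q = sigma A p q0" if "q \<in> weight_class A p q0" for q
  proof -
    have "flag_seq A p q 0 = flag_seq A p q0 0" using that by (simp add: weight_class_def)
    then show ?thesis by simp
  qed
  ultimately show ?thesis by blast
qed

lemma finite_weight_classes:
  fixes A :: "(int^'n) set"
  assumes "finite A"
  shows "finite (weight_classes A p)"
proof -
  define g where "g q = restrict (\<lambda>S. argmin_set p q S) (Pow A)" for q
  have "weight_class A p q = weight_class A p q'" if "g q = g q'" for q q'
  proof -
    have "argmin_set p q S = argmin_set p q' S" if "S \<subseteq> A" for S
      using \<open>g q = g q'\<close> that by (metis PowI g_def restrict_apply')
    then have "flag A p q = flag A p q'" using flag_eq_if_argmin_set_eq by blast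
    then show ?thesis by (simp add: weight_class_def flag_eq_iff_flag_seq_eq[OF assms])
  qed
  then have "weight_class A p q = weight_class A p (SOME q'. g q' = g q)" for q
    by (metis (mono_tags) someI)
  then have classes: "weight_classes A p \<subseteq> (\<lambda>m. weight_class A p (SOME q. g q = m)) ` range g"
    unfolding weight_classes_def by blast
  have "g q \<in> Pi\<^sub>E (Pow A) (\<lambda>_. Pow A)" for q
    unfolding g_def restrict_PiE_iff using argmin_set_subset by blast
  then have "range g \<subseteq> Pi\<^sub>E (Pow A) (\<lambda>_. Pow A)" by blast
  then show ?thesis
    using classes assms by (meson finite_PiE finite_Pow_iff finite_imageI finite_subset)
qed

lemma (in ultrametric_valuation) singular_point_weight_class_iff:
  fixes A :: "(int^'n) set"
  assumes "finite A" "q \<in> weight_class A p q0"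
  shows "singular_point val A p q \<longleftrightarrow> singular_point val A p q0"
proof -
  have flags: "flag A p q = flag A p q0" and q: "q \<in> trop_hypersurface A p"
    using assms by (auto simp: weight_class_def flag_eq_iff_flag_seq_eq)
  have "sigma A p q = sigma A p q0"
    using fun_cong[OF flags, of 1] assms(1) by (simp add: sigma_eq_argmin_set)
  then have "q0 \<in> trop_hypersurface A p"
    using q by (simp add: trop_hypersurface_def)
  then show ?thesis
    using flags q by (simp add: singular_point_iff_no_coloop[OF assms(1)] no_coloop_def)
qed

theorem proposition4p2:
  fixes A :: "(int^'n) set" and p :: "int^'n \<Rightarrow> real" and val :: "'k::field_char_0 \<Rightarrow> real"
  assumes "alg_closed TYPE('k)"
    and "nonarch_valuation val"
    and "finite A"
    and "Z_span A = UNIV"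
  shows "finite (weight_classes A p) \<and>
         (\<forall>C\<in>weight_classes A p. \<exists>P. polyhedron P \<and> C = rel_interior P) \<and>
         (\<forall>C\<in>weight_classes A p. \<exists>\<sigma>. C \<subseteq> rel_interior (dual_cell A p \<sigma>)) \<and>
         (\<forall>C\<in>weight_classes A p.
           (\<forall>q\<in>C. singular_point val A p q) \<or> (\<forall>q\<in>C. \<not> singular_point val A p q))"
proof -
  interpret ultrametric_valuation val by unfold_locales (rule assms(2))
  have "(\<exists>P. polyhedron P \<and> C = rel_interior P) \<and> (\<exists>\<sigma>. C \<subseteq> rel_interior (dual_cell A p \<sigma>)) \<and>
      ((\<forall>q\<in>C. singular_point val A p q) \<or> (\<forall>q\<in>C. \<not> singular_point val A p q))"
    if C_class: "C \<in> weight_classes A p" for C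
  proof -
    obtain q0 where q0: "q0 \<in> trop_hypersurface A p" and C: "C = weight_class A p q0"
      using C_class unfolding weight_classes_def by blast
    show ?thesis
      unfolding C
      using weight_class_rel_interior_polyhedron[OF assms(3) q0]
        weight_class_subset_rel_interior_dual_cell[OF assms(3), of p q0]
        singular_point_weight_class_iff[OF assms(3), of _ p q0]
      by blast
  qed
  then show ?thesis using finite_weight_classes[OF assms(3)] by blast
qed

end
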